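(* Let $\lambda>0$ and $0<a<1$. Let $Y$, $Z$, $B$ be mutually independent random variables, with $Y$ and $Z$ exponentially distributed with rate $\lambda$ and $B$ Bernoulli with $\mathbf P\{B=0\}=a$, $\mathbf P\{B=1\}=1-a$, and set $$X=aY+BZ .$$ Let $F(x)$ and $G(y)$ be the cumulative distribution functions of $X$ and $Y$, both of which are the exponential distribution function $(1-e^{-\lambda x})\,\mathbf 1_{\{x\ge 0\}}$, and let $H(x,y)=\mathbf P\{X\le x,\,Y\le y\}$. Then $H(x,y)=C_a(F(x),G(y))$ for all $x,y\in\mathbb R$, where $C_a$ is the copula function $$C_a(u,v)=u-(1-v)\left[1-\frac{1-u}{(1-v)^a}\right]^+=u-\frac{\big[(1-v)^a-(1-u)\big]^+}{(1-v)^{a-1}} .$$ Moreover, for $0\le a\le 1$, the family of copulas $C_a$ given by this formula runs between the two extremal copulas $C_0(u,v)=uv$ (independent marginals) and $C_1(u,v)=u\wedge v$ (fully positively correlated marginals).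
   Context: Notation: $[x]^+=\max(x,0)$ and $u\wedge v=\min(u,v)$. A copula function is a joint cumulative distribution function on $[0,1]^2$ with uniform marginals. The formula for $C_a(u,v)$ is understood for $u\in[0,1]$, $v\in[0,1)$ and is extended to $v=1$ by continuity, $C_a(u,1)=u$. *)

theory Defs
  imports "HOL-Probability.Probability"
begin

text \<open>A copula is (the restriction to the unit square of) the joint distribution function of a
  probability measure on the plane with uniform marginals on the unit interval. Values outside
  the unit square are irrelevant.\<close>

definition is_copula :: "(real \<Rightarrow> real \<Rightarrow> real) \<Rightarrow> bool" where
  "is_copula C \<longleftrightarrow>
    (\<exists>\<mu> :: (real \<times> real) measure.
       prob_space \<mu> \<and> sets \<mu> = sets borel \<and>
       distr \<mu> borel fst = uniform_measure lborel {0..1} \<and>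
       distr \<mu> borel snd = uniform_measure lborel {0..1} \<and>
       (\<forall>u\<in>{0..1}. \<forall>v\<in>{0..1}. C u v = measure \<mu> ({..u} \<times> {..v})))"

definition copulaC :: "real \<Rightarrow> real \<Rightarrow> real \<Rightarrow> real" where
  "copulaC a u v =
    (if v = 1 then u else u - (1 - v) * max (1 - (1 - u) / (1 - v) powr a) 0)"

text \<open>The value at \<open>v = 1\<close> is the continuous extension.\<close>

lemma copulaC_tendsto_at_1:
  assumes "u \<le> 1"
  shows "(copulaC a u \<longlongrightarrow> copulaC a u 1) (at_left 1)"
proof (rule tendsto_sandwich)
  show "((\<lambda>v. u - (1 - v)) \<longlongrightarrow> copulaC a u 1) (at_left 1)"
    unfolding copulaC_def by (auto intro!: tendsto_eq_intros)
  show "((\<lambda>v. u) \<longlongrightarrow> copulaC a u 1) (at_left 1)"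
    unfolding copulaC_def by simp
  show "\<forall>\<^sub>F v in at_left 1. copulaC a u v \<le> u"
    using eventually_at_left_real[of 0 1]
    by (auto elim!: eventually_mono simp: copulaC_def)
  have lower: "u - (1 - v) \<le> copulaC a u v" if "v < 1" for v
  proof -
    have "0 \<le> (1 - u) / (1 - v) powr a"
      using assms by simp
    then have "(1 - v) * max (1 - (1 - u) / (1 - v) powr a) 0 \<le> (1 - v) * 1"
      using that by (intro mult_left_mono) auto
    moreover have "copulaC a u v = u - (1 - v) * max (1 - (1 - u) / (1 - v) powr a) 0"
      using that by (simp add: copulaC_def)
    ultimately show ?thesis
      by (metis diff_left_mono mult.right_neutral)
  qed
  show "\<forall>\<^sub>F v in at_left 1. u - (1 - v) \<le> copulaC a u v"
    using eventually_at_left_real[of 0 1]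
    by (rule eventually_mono) (use lower in auto)
qed

end

theory Submission
  imports Defs
begin

text \<open>Conditioning on \<open>B\<close> and then on \<open>Y\<close> reduces the joint law to an elementary integral over
  \<open>{0..m}\<close>, where \<open>m = min y (x / a)\<close>; the positive part in \<open>C\<^sub>a\<close> records which of the two terms
  is the minimum. The marginal law of \<open>X\<close> is the limit \<open>y \<rightarrow> \<infinity>\<close>. The same computation is valid
  for \<open>0 \<le> a \<le> 1\<close>, so for each such \<open>a\<close>, taking rate 1, the pair
  \<open>(1 - exp (- X), 1 - exp (- Y))\<close> has uniform marginals and joint distribution function \<open>C\<^sub>a\<close>,
  which makes \<open>C\<^sub>a\<close> a copula.\<close>

section \<open>Elementary values of the copula formula\<close>

text \<open>In the coordinates \<open>1 - u = exp (- l * x)\<close> and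
  \<open>1 - v = exp (- l * y)\<close>, dividing by \<open>(1 - v) powr a\<close> shifts the
  exponent, from \<open>x\<close> to \<open>x - a * y\<close>. The sign of the bracket is thus the
  sign of \<open>x - a * y\<close> when \<open>l > 0\<close>.\<close>

lemma copulaC_exponential:
  "copulaC a (1 - exp (- l * x)) (1 - exp (- l * y)) =
    1 - exp (- l * x) - exp (- l * y) * max (1 - exp (- l * (x - a * y))) 0"
proof -
  have "exp (- l * x) / exp (- l * y) powr a = exp (- l * (x - a * y))"
    by (simp add: exp_powr_real flip: exp_diff) (simp add: algebra_simps)
  then show ?thesis
    by (simp add: copulaC_def)
qed

lemma copulaC_0_right: "0 \<le> u \<Longrightarrow> copulaC a u 0 = 0"
  by (simp add: copulaC_def)

text \<open>For \<open>v < 1\<close> the quotient \<open>1 / (1 - v) powr a\<close> is at least 1,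
  so the positive part vanishes. This value serves negative \<open>x\<close>, where the distribution
  function of \<open>X\<close> is 0.\<close>

lemma copulaC_0_left:
  assumes "0 \<le> a" "0 \<le> v" "v \<le> 1"
  shows "copulaC a 0 v = 0"
proof (cases "v = 1")
  case False
  then have "0 < (1 - v) powr a" "(1 - v) powr a \<le> 1"
    using assms by (auto intro: powr_le1)
  then show ?thesis
    by (simp add: copulaC_def max_def)
qed (simp add: copulaC_def)

section \<open>Conditioning on the Bernoulli variable and on \<open>Y\<close>\<close>

lemma (in prob_space) cdf_distr:
  assumes [measurable]: "random_variable borel V"
  shows "cdf (distr M borel V) x = prob {\<omega> \<in> space M. V \<omega> \<le> x}"
  unfolding cdf_def by (subst measure_distr) (auto intro!: arg_cong[where f=prob])

text \<open>Total probability over the two values of \<open>B\<close>: on the event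
  \<open>B = b\<close> the predicate may be read with the constant \<open>b\<close>, and
  independence then factors out the probability of that event. Measurability is asked of each slice
  \<open>P b\<close> and of the composite with \<open>B\<close>, so \<open>P\<close> may depend on
  \<open>b\<close> in any way.\<close>

lemma (in prob_space) indep_vars_mixture:
  fixes Y Z B :: "'a \<Rightarrow> real"
  assumes ind: "indep_vars (\<lambda>_. borel) (\<lambda>i::nat. [Y, Z, B] ! i) {0, 1, 2}"
    and B01: "prob {\<omega> \<in> space M. B \<omega> = 0} = a" "prob {\<omega> \<in> space M. B \<omega> = 1} = 1 - a"
    and P: "\<And>b. Measurable.pred (borel \<Otimes>\<^sub>M borel) (\<lambda>(s, t). P b s t)"
    and PB: "Measurable.pred M (\<lambda>\<omega>. P (B \<omega>) (Y \<omega>) (Z \<omega>))"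
  shows "prob {\<omega> \<in> space M. P (B \<omega>) (Y \<omega>) (Z \<omega>)} =
    a * prob {\<omega> \<in> space M. P 0 (Y \<omega>) (Z \<omega>)} + (1 - a) * prob {\<omega> \<in> space M. P 1 (Y \<omega>) (Z \<omega>)}"
proof -
  have rv: "random_variable borel ([Y, Z, B] ! i)" if "i \<in> {0,1,2}" for i
    using ind that by (auto simp: indep_vars_def)
  have [measurable]: "random_variable borel Y" "random_variable borel Z" "random_variable borel B"
    using rv[of 0] rv[of 1] rv[of 2] by simp_all
  note PB[measurable] P[measurable (raw)]
  \<comment> \<open>Grouping the indices into \<open>{0,1}\<close> and \<open>{2}\<close> gives
    independence of the pair \<open>(Y, Z)\<close> from \<open>B\<close>, which pairwise
    independence would not give.\<close>
  have YZ_B: "indep_var (PiM {0,1} (\<lambda>_. borel)) (\<lambda>\<omega>. restrict (\<lambda>i. ([Y, Z, B] ! i) \<omega>) {0,1})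
      (PiM {2} (\<lambda>_. borel)) (\<lambda>\<omega>. restrict (\<lambda>i. ([Y, Z, B] ! i) \<omega>) {2})"
    using ind by (rule indep_var_restrict) auto
  have slice: "prob {\<omega> \<in> space M. P (B \<omega>) (Y \<omega>) (Z \<omega>) \<and> B \<omega> = b} =
      prob {\<omega> \<in> space M. B \<omega> = b} * prob {\<omega> \<in> space M. P b (Y \<omega>) (Z \<omega>)}" for b
  proof -
    have "{f \<in> space (PiM {0,1} (\<lambda>_. borel)). P b (f 0) (f (1::nat))} \<in> sets (PiM {0,1} (\<lambda>_. borel))"
      "{f \<in> space (PiM {2} (\<lambda>_. borel)). f (2::nat) = b} \<in> sets (PiM {2} (\<lambda>_. borel))"
      using measurable_compose[OF _ P[of b], of "\<lambda>f. (f 0, f 1)" "PiM {0,1::nat} (\<lambda>_. borel)"]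
      by (simp_all add: pred_def)
    from indep_varD[OF YZ_B this] show ?thesis
      by (simp add: space_PiM vimage_def Int_def conj_commute mult.commute cong: conj_cong)
  qed
  \<comment> \<open>The two atoms have total mass 1, so \<open>B\<close> takes no other value almost
    surely.\<close>
  have "prob {\<omega> \<in> space M. B \<omega> = 0 \<or> B \<omega> = 1} =
      prob ({\<omega> \<in> space M. B \<omega> = 0} \<union> {\<omega> \<in> space M. B \<omega> = 1})"
    by (intro arg_cong[where f=prob]) auto
  also have "\<dots> = a + (1 - a)"
    unfolding B01[symmetric] by (subst finite_measure_Union) (auto simp: B01)
  finally have "AE \<omega> in M. B \<omega> = 0 \<or> B \<omega> = 1"
    by (subst prob_Collect_eq_1[symmetric]) auto
  then have "prob {\<omega> \<in> space M. P (B \<omega>) (Y \<omega>) (Z \<omega>)} =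
      prob ({\<omega> \<in> space M. P (B \<omega>) (Y \<omega>) (Z \<omega>) \<and> B \<omega> = 0} \<union>
        {\<omega> \<in> space M. P (B \<omega>) (Y \<omega>) (Z \<omega>) \<and> B \<omega> = 1})"
    by (intro finite_measure_eq_AE) auto
  also have "\<dots> = prob {\<omega> \<in> space M. P (B \<omega>) (Y \<omega>) (Z \<omega>) \<and> B \<omega> = 0} +
      prob {\<omega> \<in> space M. P (B \<omega>) (Y \<omega>) (Z \<omega>) \<and> B \<omega> = 1}"
    by (rule finite_measure_Union) auto
  finally show ?thesis
    by (simp add: slice B01)
qed

text \<open>The factor \<open>1 - a\<close> is kept on both sides because the integrand on its own has
  the antiderivative \<open>exp (- l * (1 - a) * s) / (1 - a)\<close>, undefined for \<open>a = 1\<close>.\<close>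

lemma (in prob_space) prob_indep_exponential:
  assumes l: "0 < l"
    and Y: "distributed M lborel Y (exponential_density l)"
    and Z: "distributed M lborel Z (exponential_density l)"
    and ind: "indep_var borel Y borel Z"
    and a: "a \<le> 1" and m: "0 \<le> m"
    and eq: "\<And>s. 0 \<le> s \<Longrightarrow> a * s \<le> x \<and> s \<le> y \<longleftrightarrow> s \<le> m"
  shows "(1 - a) * prob {\<omega> \<in> space M. a * Y \<omega> + Z \<omega> \<le> x \<and> Y \<omega> \<le> y} =
    (1 - a) * (1 - exp (- l * m)) - exp (- l * x) * (1 - exp (- l * (1 - a) * m))"
proof -
  have [measurable]: "random_variable borel Y" "random_variable borel Z"
    using ind by (auto dest: indep_var_rv1 indep_var_rv2)
  let ?E = "density lborel (exponential_density l)"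
  have dY: "distr M borel Y = ?E" and dZ: "distr M borel Z = ?E"
    using Y Z by (auto simp: distributed_def cong: distr_cong)
  interpret E: prob_space ?E
    by (rule prob_space_exponential_density[OF l])
  have [measurable]: "erlang_CDF 0 l \<in> borel_measurable borel"
    unfolding erlang_CDF_0[abs_def] by measurable
  let ?A = "{(s, t). a * s + t \<le> x \<and> s \<le> y} :: (real \<times> real) set"
  have A: "?A \<in> sets (borel \<Otimes>\<^sub>M borel)"
  proof -
    have "?A = {p \<in> space (borel \<Otimes>\<^sub>M borel). a * fst p + snd p \<le> x \<and> fst p \<le> y}"
      by (auto simp: space_pair_measure)
    also have "\<dots> \<in> sets (borel \<Otimes>\<^sub>M borel)"
      by measurable
    finally show ?thesis .
  qed
  have le: "a * s \<le> x" if "s \<le> m" "0 \<le> s" for s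
    using that eq by blast
  define K where "K s = - (1 - a) * exp (- l * s) + exp (- l * x) * exp (- l * (1 - a) * s)" for s
  have K: "(K has_real_derivative (1 - a) * (l * exp (- l * s)) * (1 - exp (- l * (x - a * s)))) (at s)" for s
  proof -
    have "exp (- l * x) * exp (- l * (1 - a) * s) = exp (- l * s) * exp (- l * (x - a * s))"
      by (simp flip: exp_add) (simp add: algebra_simps)
    then have eq: "(1 - a) * (l * exp (- l * s)) * (1 - exp (- l * (x - a * s))) =
        (1 - a) * l * exp (- l * s) - (1 - a) * l * (exp (- l * x) * exp (- l * (1 - a) * s))"
      by (simp only:) (simp add: algebra_simps)
    show ?thesis
      unfolding K_def eq by (auto intro!: derivative_eq_intros simp: algebra_simps)
  qed
  have nonneg: "0 \<le> (1 - a) * (l * exp (- l * s)) * (1 - exp (- l * (x - a * s)))"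
    if "0 \<le> s" "s \<le> m" for s
    using le[OF that(2,1)] a l by (intro mult_nonneg_nonneg) auto
  \<comment> \<open>The integral is computed in \<open>ennreal\<close>; this sign condition allows
    the return to an equation between reals.\<close>
  have "K 0 \<le> K m"
    by (rule DERIV_nonneg_imp_nondecreasing[OF m]) (intro exI conjI, rule K, rule nonneg)
  have "ennreal ((1 - a) * prob {\<omega> \<in> space M. a * Y \<omega> + Z \<omega> \<le> x \<and> Y \<omega> \<le> y}) =
      ennreal (1 - a) * emeasure M {\<omega> \<in> space M. a * Y \<omega> + Z \<omega> \<le> x \<and> Y \<omega> \<le> y}"
    using a by (simp add: emeasure_eq_measure ennreal_mult)
  also have "emeasure M {\<omega> \<in> space M. a * Y \<omega> + Z \<omega> \<le> x \<and> Y \<omega> \<le> y} =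
      emeasure (distr M (borel \<Otimes>\<^sub>M borel) (\<lambda>\<omega>. (Y \<omega>, Z \<omega>))) ?A"
    using A by (subst emeasure_distr) (auto intro!: arg_cong2[where f=emeasure])
  also have "\<dots> = emeasure (?E \<Otimes>\<^sub>M ?E) ?A"
    using ind by (simp add: indep_var_distribution_eq dY dZ)
  \<comment> \<open>Fubini: for fixed \<open>Y = s\<close> what remains is the probability of
    \<open>Z \<le> x - a * s\<close>, a value of the exponential distribution function.\<close>
  also have "\<dots> = (\<integral>\<^sup>+ s. emeasure ?E (Pair s -` ?A) \<partial>?E)"
    using A by (intro E.emeasure_pair_measure_alt) (simp cong: sets_pair_measure_cong)
  also have "\<dots> = (\<integral>\<^sup>+ s. (if s \<le> y then ennreal (erlang_CDF 0 l (x - a * s)) else 0) \<partial>?E)"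
  proof (rule nn_integral_cong)
    fix s :: real
    have "Pair s -` ?A = (if s \<le> y then {..x - a * s} else {})"
      by auto
    then show "emeasure ?E (Pair s -` ?A) = (if s \<le> y then ennreal (erlang_CDF 0 l (x - a * s)) else 0)"
      by (simp add: emeasure_erlang_density[OF l])
  qed
  also have "\<dots> = (\<integral>\<^sup>+ s. ennreal (exponential_density l s) *
      (if s \<le> y then ennreal (erlang_CDF 0 l (x - a * s)) else 0) \<partial>lborel)"
    by (rule nn_integral_density) measurable
  also have "ennreal (1 - a) * \<dots> = (\<integral>\<^sup>+ s. ennreal (1 - a) * (ennreal (exponential_density l s) *
      (if s \<le> y then ennreal (erlang_CDF 0 l (x - a * s)) else 0)) \<partial>lborel)"
    by (rule nn_integral_cmult[symmetric]) measurable
  \<comment> \<open>The density vanishes for \<open>s < 0\<close> and the distribution function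
    vanishes when \<open>a * s > x\<close>. By \<open>eq\<close>, the remaining range is exactly
    \<open>{0..m}\<close>.\<close>
  also have "\<dots> = (\<integral>\<^sup>+ s. ennreal ((1 - a) * (l * exp (- l * s)) * (1 - exp (- l * (x - a * s)))) *
      indicator {0..m} s \<partial>lborel)"
  proof (rule nn_integral_cong)
    fix s :: real
    show "ennreal (1 - a) * (ennreal (exponential_density l s) *
        (if s \<le> y then ennreal (erlang_CDF 0 l (x - a * s)) else 0)) =
      ennreal ((1 - a) * (l * exp (- l * s)) * (1 - exp (- l * (x - a * s)))) * indicator {0..m} s"
      using eq[of s] a l
      by (auto simp: exponential_density_def erlang_CDF_0 indicator_def ennreal_mult' mult.assoc
          mult.commute[of l] simp flip: ennreal_mult')
  qed
  also have "\<dots> = ennreal (K m - K 0)"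
    by (rule nn_integral_FTC_Icc) (use m K nonneg in \<open>auto intro: has_field_derivative_at_within\<close>)
  finally have "(1 - a) * prob {\<omega> \<in> space M. a * Y \<omega> + Z \<omega> \<le> x \<and> Y \<omega> \<le> y} = K m - K 0"
    using a \<open>K 0 \<le> K m\<close> by (subst (asm) ennreal_inj) auto
  then show ?thesis
    by (simp add: K_def algebra_simps)
qed

section \<open>Joint and marginal laws of the mixture\<close>

text \<open>The end points \<open>a = 0\<close> and \<open>a = 1\<close> are included: there
  \<open>X\<close> equals \<open>Z\<close> and \<open>Y\<close> respectively, almost surely, which
  is where the two extremal copulas come from.\<close>

locale exponential_mixture = prob_space +
  fixes Y Z B :: "'a \<Rightarrow> real" and l a :: real
  assumes l: "0 < l" and a: "0 \<le> a" "a \<le> 1"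
    and ind: "indep_vars (\<lambda>_. borel) (\<lambda>i::nat. [Y, Z, B] ! i) {0, 1, 2}"
    and Y: "distributed M lborel Y (exponential_density l)"
    and Z: "distributed M lborel Z (exponential_density l)"
    and B01: "prob {\<omega> \<in> space M. B \<omega> = 0} = a" "prob {\<omega> \<in> space M. B \<omega> = 1} = 1 - a"
begin

definition X :: "'a \<Rightarrow> real" where
  "X \<omega> = a * Y \<omega> + B \<omega> * Z \<omega>"

lemma measurable_YZB [measurable]:
  "random_variable borel Y" "random_variable borel Z" "random_variable borel B"
proof -
  have "random_variable borel ([Y, Z, B] ! i)" if "i \<in> {0,1,2}" for i
    using ind that by (auto simp: indep_vars_def)
  from this[of 0] this[of 1] this[of 2]
  show "random_variable borel Y" "random_variable borel Z" "random_variable borel B"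
    by simp_all
qed

lemma measurable_X [measurable]: "random_variable borel X"
  unfolding X_def[abs_def] by measurable

lemma joint_cdf_nonneg:
  assumes xy: "0 \<le> x" "0 \<le> y"
  shows "prob {\<omega> \<in> space M. X \<omega> \<le> x \<and> Y \<omega> \<le> y} =
    copulaC a (1 - exp (- l * x)) (1 - exp (- l * y))"
proof -
  have "indep_var (PiM {0} (\<lambda>_. borel)) (\<lambda>\<omega>. restrict (\<lambda>i. ([Y, Z, B] ! i) \<omega>) {0})
      (PiM {1} (\<lambda>_. borel)) (\<lambda>\<omega>. restrict (\<lambda>i. ([Y, Z, B] ! i) \<omega>) {1})"
    using ind by (rule indep_var_restrict) auto
  then have "indep_var borel ((\<lambda>f. f 0) \<circ> (\<lambda>\<omega>. restrict (\<lambda>i. ([Y, Z, B] ! i) \<omega>) {0}))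
      borel ((\<lambda>f. f 1) \<circ> (\<lambda>\<omega>. restrict (\<lambda>i. ([Y, Z, B] ! i) \<omega>) {1}))"
    by (rule indep_var_compose) measurable
  then have YZ: "indep_var borel Y borel Z"
    by (simp add: comp_def)
  \<comment> \<open>This is the minimum of \<open>y\<close> and \<open>x / a\<close>. Testing
    \<open>a * y \<le> x\<close> makes \<open>a = 0\<close> select \<open>y\<close>, rather than the
    value 0 of \<open>x / 0\<close>.\<close>
  define m where "m = (if a * y \<le> x then y else x / a)"
  have m0: "0 \<le> m"
    using xy a by (simp add: m_def)
  have eq: "a * s \<le> x \<and> s \<le> y \<longleftrightarrow> s \<le> m" for s
  proof (cases "a * y \<le> x")
    case True
    moreover have "a * s \<le> a * y" if "s \<le> y"
      using that a by (intro mult_left_mono)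
    ultimately show ?thesis
      by (auto simp: m_def)
  next
    case False
    then have "0 < a"
      using a xy by (cases "a = 0") auto
    moreover have "s \<le> y" if "a * s \<le> x"
      using that False \<open>0 < a\<close> by (smt (verit) mult_left_mono)
    ultimately show ?thesis
      using False by (auto simp: m_def field_simps)
  qed
  have "prob {\<omega> \<in> space M. X \<omega> \<le> x \<and> Y \<omega> \<le> y} =
      a * prob {\<omega> \<in> space M. a * Y \<omega> + 0 * Z \<omega> \<le> x \<and> Y \<omega> \<le> y} +
      (1 - a) * prob {\<omega> \<in> space M. a * Y \<omega> + 1 * Z \<omega> \<le> x \<and> Y \<omega> \<le> y}"
    unfolding X_def using ind B01 by (rule indep_vars_mixture) measurable
  also have "prob {\<omega> \<in> space M. a * Y \<omega> + 0 * Z \<omega> \<le> x \<and> Y \<omega> \<le> y} = 1 - exp (- l * m)"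
    using exponential_distributedD_le[OF Y m0 l] by (simp add: eq mult.commute)
  also have "(1 - a) * prob {\<omega> \<in> space M. a * Y \<omega> + 1 * Z \<omega> \<le> x \<and> Y \<omega> \<le> y} =
      (1 - a) * (1 - exp (- l * m)) - exp (- l * x) * (1 - exp (- l * (1 - a) * m))"
    using prob_indep_exponential[OF l Y Z YZ a(2) m0 eq] by simp
  \<comment> \<open>The weights \<open>a\<close> and \<open>1 - a\<close> of the common term
    \<open>1 - exp (- l * m)\<close> add up to 1.\<close>
  also have "a * (1 - exp (- l * m)) + \<dots> =
      1 - exp (- l * m) - exp (- l * x) + exp (- l * (x + (1 - a) * m))"
    by (simp add: algebra_simps flip: exp_add)
  also have "\<dots> = 1 - exp (- l * x) - exp (- l * y) * max (1 - exp (- l * (x - a * y))) 0"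
  proof (cases "a * y \<le> x")
    case True
    then show ?thesis
      using l by (simp add: m_def max_def algebra_simps flip: exp_add)
  next
    case False
    then have "a \<noteq> 0"
      using xy by auto
    \<comment> \<open>Since \<open>m = x / a\<close>, the two exponentials containing
      \<open>m\<close> cancel and \<open>1 - exp (- l * x)\<close> is left. The positive part is 0
      in this case.\<close>
    then have "x + (1 - a) * m = m"
      using False by (simp add: m_def field_simps)
    then show ?thesis
      using False l by (simp add: max_def mult_le_0_iff)
  qed
  finally show ?thesis
    using copulaC_exponential by simp
qed

lemma cdf_Y: "cdf (distr M borel Y) y = (if 0 \<le> y then 1 - exp (- l * y) else 0)"
proof -
  have nonneg: "prob {\<omega> \<in> space M. Y \<omega> \<le> y} = 1 - exp (- l * y)" if "0 \<le> y" for y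
    using exponential_distributedD_le[OF Y that l] by (simp add: mult.commute)
  have "prob {\<omega> \<in> space M. Y \<omega> \<le> y} \<le> prob {\<omega> \<in> space M. Y \<omega> \<le> 0}" if "y < 0"
    using that by (intro finite_measure_mono) auto
  moreover have "cdf (distr M borel Y) y = prob {\<omega> \<in> space M. Y \<omega> \<le> y}"
    by (simp add: cdf_distr)
  ultimately show ?thesis
    using nonneg[of 0] nonneg[of y] by (simp add: measure_le_0_iff)
qed

text \<open>For \<open>x \<ge> 0\<close> the events with \<open>Y \<le> n\<close> increase to the
  event \<open>X \<le> x\<close>, while their probabilities converge by continuity of the copula
  formula at \<open>v = 1\<close>. Negative \<open>x\<close> follow by monotonicity from the value 0
  at \<open>x = 0\<close>.\<close>

lemma cdf_X: "cdf (distr M borel X) x = (if 0 \<le> x then 1 - exp (- l * x) else 0)"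
proof -
  have nonneg: "prob {\<omega> \<in> space M. X \<omega> \<le> x} = 1 - exp (- l * x)" if "0 \<le> x" for x
  proof (rule LIMSEQ_unique)
    have "(\<lambda>n. prob {\<omega> \<in> space M. X \<omega> \<le> x \<and> Y \<omega> \<le> real n}) \<longlonglongrightarrow>
        prob (\<Union>n. {\<omega> \<in> space M. X \<omega> \<le> x \<and> Y \<omega> \<le> real n})"
      by (rule finite_Lim_measure_incseq) (auto simp: incseq_def)
    also have "(\<Union>n. {\<omega> \<in> space M. X \<omega> \<le> x \<and> Y \<omega> \<le> real n}) = {\<omega> \<in> space M. X \<omega> \<le> x}"
      using real_arch_simple by blast
    finally show "(\<lambda>n. prob {\<omega> \<in> space M. X \<omega> \<le> x \<and> Y \<omega> \<le> real n}) \<longlonglongrightarrow>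
        prob {\<omega> \<in> space M. X \<omega> \<le> x}" .
    \<comment> \<open>The approach to 1 is strictly from below, matching the one-sided limit known
      for \<open>copulaC\<close>.\<close>
    have "filterlim (\<lambda>n. 1 - exp (- l * real n)) (at_left 1) sequentially"
    proof (rule tendsto_imp_filterlim_at_left)
      have "(\<lambda>n. exp (- l) ^ n) \<longlonglongrightarrow> 0"
        using l by (intro LIMSEQ_power_zero) simp
      then have "(\<lambda>n. 1 - exp (- l) ^ n) \<longlonglongrightarrow> 1 - 0"
        by (rule tendsto_diff[OF tendsto_const])
      then show "(\<lambda>n. 1 - exp (- l * real n)) \<longlonglongrightarrow> 1"
        by (simp add: mult.commute exp_of_nat_mult[symmetric])
    qed simp
    then have "(\<lambda>n. copulaC a (1 - exp (- l * x)) (1 - exp (- l * real n))) \<longlonglongrightarrow>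
        copulaC a (1 - exp (- l * x)) 1"
      by (rule filterlim_compose[OF copulaC_tendsto_at_1, rotated]) simp
    then show "(\<lambda>n. prob {\<omega> \<in> space M. X \<omega> \<le> x \<and> Y \<omega> \<le> real n}) \<longlonglongrightarrow> 1 - exp (- l * x)"
      using that by (simp add: joint_cdf_nonneg) (simp add: copulaC_def)
  qed
  have "prob {\<omega> \<in> space M. X \<omega> \<le> x} \<le> prob {\<omega> \<in> space M. X \<omega> \<le> 0}" if "x < 0"
    using that by (intro finite_measure_mono) auto
  moreover have "cdf (distr M borel X) x = prob {\<omega> \<in> space M. X \<omega> \<le> x}"
    by (simp add: cdf_distr)
  ultimately show ?thesis
    using nonneg[of 0] nonneg[of x] by (simp add: measure_le_0_iff)
qed

text \<open>When \<open>x\<close> or \<open>y\<close> is negative, both sides are 0: the joint event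
  lies in a marginal event of probability 0, and the copula formula vanishes on the axes.\<close>

theorem joint_cdf:
  "prob {\<omega> \<in> space M. X \<omega> \<le> x \<and> Y \<omega> \<le> y} =
    copulaC a (cdf (distr M borel X) x) (cdf (distr M borel Y) y)"
proof (cases "0 \<le> x \<and> 0 \<le> y")
  case True
  then show ?thesis
    by (simp add: joint_cdf_nonneg cdf_X cdf_Y)
next
  case False
  have X: "cdf (distr M borel X) x = prob {\<omega> \<in> space M. X \<omega> \<le> x}"
    and Y: "cdf (distr M borel Y) y = prob {\<omega> \<in> space M. Y \<omega> \<le> y}"
    by (simp_all add: cdf_distr)
  have "prob {\<omega> \<in> space M. X \<omega> \<le> x \<and> Y \<omega> \<le> y} \<le> cdf (distr M borel X) x"
    "prob {\<omega> \<in> space M. X \<omega> \<le> x \<and> Y \<omega> \<le> y} \<le> cdf (distr M borel Y) y"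
    unfolding X Y by (auto intro!: finite_measure_mono)
  moreover have "cdf (distr M borel X) x = 0 \<or> cdf (distr M borel Y) y = 0"
    using False by (auto simp: cdf_X cdf_Y)
  ultimately have "prob {\<omega> \<in> space M. X \<omega> \<le> x \<and> Y \<omega> \<le> y} = 0"
    by (auto simp: measure_le_0_iff)
  moreover have "copulaC a (cdf (distr M borel X) x) (cdf (distr M borel Y) y) = 0"
    using False a l copulaC_0_left copulaC_0_right
    by (auto simp: cdf_X cdf_Y)
  ultimately show ?thesis
    by simp
qed

end

section \<open>Existence of the mixture\<close>

text \<open>The coordinates of a three-fold product space realize \<open>Y\<close>, \<open>Z\<close>
  and \<open>B\<close>. A concrete model is required because being a copula asserts that a measure
  exists.\<close>

lemma exponential_mixture_exists:
  assumes a: "0 \<le> a" "a \<le> 1" and l: "0 < l"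
  obtains M :: "(nat \<Rightarrow> real) measure" and Y Z B where "exponential_mixture M Y Z B l a"
proof -
  let ?E = "density lborel (exponential_density l)"
  \<comment> \<open>The parameter of \<open>bernoulli_pmf\<close> is the probability of
    \<open>True\<close>, which \<open>of_bool\<close> sends to 1; hence
    \<open>1 - a\<close>.\<close>
  define D where "D = distr (measure_pmf (bernoulli_pmf (1 - a))) borel (of_bool :: bool \<Rightarrow> real)"
  define N where "N i = (if i = (2::nat) then D else ?E)" for i
  have "of_bool -` {0 :: real} = {False}" "of_bool -` {1 :: real} = {True}"
    by auto
  then have D: "measure D {0} = a" "measure D {1} = 1 - a"
    using a by (simp_all add: D_def measure_distr measure_pmf_single)
  have prob_N: "prob_space (N i)" for i
    using prob_space_exponential_density[OF l]
    by (auto simp: N_def D_def intro!: prob_space.prob_space_distr prob_space_measure_pmf)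
  have sets_N [measurable_cong]: "sets (N i) = sets borel" for i
    by (simp add: N_def D_def)
  let ?I = "{0, 1, 2::nat}"
  interpret P: prob_space "PiM ?I N"
    by (rule prob_space_PiM) (rule prob_N)
  have marginal: "distr (PiM ?I N) borel (\<lambda>\<omega>. \<omega> i) = N i" if "i \<in> ?I" for i
    using distr_PiM_component[of ?I N i] prob_N that by (simp cong: distr_cong add: sets_N)
  \<comment> \<open>Independence is tested on the joint law: the tuple of all coordinates is the
    identity, and its law is the product of the marginals.\<close>
  have "P.indep_vars N (\<lambda>i \<omega>. \<omega> i) ?I"
  proof (subst P.indep_vars_iff_distr_eq_PiM')
    have "distr (PiM ?I N) (PiM ?I N) (\<lambda>\<omega>. restrict \<omega> ?I) = distr (PiM ?I N) (PiM ?I N) (\<lambda>\<omega>. \<omega>)"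
      by (intro distr_cong) (auto simp: space_PiM PiE_def extensional_restrict)
    also have "\<dots> = (\<Pi>\<^sub>M i\<in>?I. distr (PiM ?I N) (N i) (\<lambda>\<omega>. \<omega> i))"
      using prob_N by (simp add: distr_id cong: PiM_cong) (intro PiM_cong, auto simp: distr_PiM_component)
    finally show "distr (PiM ?I N) (PiM ?I N) (\<lambda>\<omega>. \<lambda>i\<in>?I. \<omega> i) =
      (\<Pi>\<^sub>M i\<in>?I. distr (PiM ?I N) (N i) (\<lambda>\<omega>. \<omega> i))" .
  qed auto
  then have "P.indep_vars (\<lambda>_. borel) (\<lambda>i \<omega>. \<omega> i) ?I"
    by (rule P.indep_vars_compose2) simp
  also have "?this \<longleftrightarrow> P.indep_vars (\<lambda>_. borel) (\<lambda>i. [\<lambda>\<omega>. \<omega> 0, \<lambda>\<omega>. \<omega> 1, \<lambda>\<omega>. \<omega> 2] ! i) ?I"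
    by (intro P.indep_vars_cong) auto
  finally have ind: "P.indep_vars (\<lambda>_. borel) (\<lambda>i. [\<lambda>\<omega>. \<omega> 0, \<lambda>\<omega>. \<omega> 1, \<lambda>\<omega>. \<omega> 2] ! i) ?I" .
  have exponential: "distributed (PiM ?I N) lborel (\<lambda>\<omega>. \<omega> i) (exponential_density l)"
    if "i \<in> {0, 1}" for i
  proof -
    have "i \<in> ?I"
      using that by auto
    then have "distr (PiM ?I N) lborel (\<lambda>\<omega>. \<omega> i) = ?E"
      using marginal[of i] that by (auto simp: N_def cong: distr_cong)
    then show ?thesis
      using \<open>i \<in> ?I\<close> l by (auto simp: distributed_def measurable_component_singleton)
  qed
  have bernoulli: "P.prob {\<omega> \<in> space (PiM ?I N). \<omega> 2 = b} = measure D {b}" for b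
  proof -
    have "measure D {b} = measure (distr (PiM ?I N) borel (\<lambda>\<omega>. \<omega> 2)) {b}"
      using marginal[of 2] by (simp add: N_def)
    also have "\<dots> = P.prob {\<omega> \<in> space (PiM ?I N). \<omega> 2 = b}"
      by (subst measure_distr) (auto intro!: arg_cong2[where f=measure])
    finally show ?thesis ..
  qed
  have "exponential_mixture (PiM ?I N) (\<lambda>\<omega>. \<omega> 0) (\<lambda>\<omega>. \<omega> 1) (\<lambda>\<omega>. \<omega> 2) l a"
    using a l ind exponential[of 0] exponential[of 1] bernoulli D
    by unfold_locales auto
  then show ?thesis
    by (rule that)
qed

section \<open>Uniform marginals and the copula property\<close>

lemma one_minus_exp_le_iff:
  fixes t u :: real
  shows "u < 1 \<Longrightarrow> 1 - exp (- t) \<le> u \<longleftrightarrow> t \<le> - ln (1 - u)"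
  using exp_le_cancel_iff[of "ln (1 - u)" "- t"] by auto

text \<open>The probability integral transform for rate 1. The two laws agree because their
  distribution functions do; below 1 the quantile function \<open>- ln (1 - u)\<close> reduces the
  claim to the law of \<open>X\<close>.\<close>

lemma (in prob_space) uniform_transform_exponential:
  assumes [measurable]: "random_variable borel X"
    and X: "\<And>x. cdf (distr M borel X) x = (if 0 \<le> x then 1 - exp (- x) else 0)"
  shows "distr M borel (\<lambda>\<omega>. 1 - exp (- X \<omega>)) = uniform_measure lborel {0..1}"
proof (rule cdf_unique)
  show "real_distribution (distr M borel (\<lambda>\<omega>. 1 - exp (- X \<omega>)))"
    by (intro real_distribution_distr) measurable
  show "real_distribution (uniform_measure lborel {0..1})"
    by (intro real_distribution.intro real_distribution_axioms.intro prob_space_uniform_measure) auto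
  show "cdf (distr M borel (\<lambda>\<omega>. 1 - exp (- X \<omega>))) = cdf (uniform_measure lborel {0..1})"
  proof
    fix u :: real
    have "cdf (distr M borel (\<lambda>\<omega>. 1 - exp (- X \<omega>))) u = (if u \<le> 0 then 0 else min 1 u)"
    proof (cases "u < 1")
      case True
      then have "cdf (distr M borel (\<lambda>\<omega>. 1 - exp (- X \<omega>))) u = cdf (distr M borel X) (- ln (1 - u))"
        by (simp add: cdf_distr one_minus_exp_le_iff)
      then show ?thesis
        using True by (auto simp: X)
    next
      case False
      \<comment> \<open>The transformed variable stays below 1, so for \<open>u \<ge> 1\<close> the
        event is the whole space.\<close>
      then have "1 - exp (- t) \<le> u" for t
        using exp_gt_zero[of "- t"] by linarith
      then show ?thesis
        using False by (simp add: cdf_distr prob_space)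
    qed
    also have "\<dots> = cdf (uniform_measure lborel {0..1}) u"
      by (auto simp: cdf_def min_def)
    finally show "cdf (distr M borel (\<lambda>\<omega>. 1 - exp (- X \<omega>))) u = cdf (uniform_measure lborel {0..1}) u" .
  qed
qed

lemma is_copula_copulaC:
  assumes "0 \<le> a" "a \<le> 1"
  shows "is_copula (copulaC a)"
proof -
  obtain M :: "(nat \<Rightarrow> real) measure" and Y Z B where "exponential_mixture M Y Z B 1 a"
    using exponential_mixture_exists[OF assms zero_less_one] .
  then interpret exponential_mixture M Y Z B 1 a .
  define \<mu> where "\<mu> = distr M borel (\<lambda>\<omega>. (1 - exp (- X \<omega>), 1 - exp (- Y \<omega>)))"
  have U: "distr M borel (\<lambda>\<omega>. 1 - exp (- X \<omega>)) = uniform_measure lborel {0..1}"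
    and V: "distr M borel (\<lambda>\<omega>. 1 - exp (- Y \<omega>)) = uniform_measure lborel {0..1}"
    by (intro uniform_transform_exponential; simp add: cdf_X cdf_Y)+
  have fst: "distr \<mu> borel fst = uniform_measure lborel {0..1}"
    and snd: "distr \<mu> borel snd = uniform_measure lborel {0..1}"
    unfolding \<mu>_def by (subst distr_distr; simp add: U V comp_def flip: borel_prod)+
  have C: "copulaC a u v = measure \<mu> ({..u} \<times> {..v})" if "u \<in> {0..1}" "v \<in> {0..1}" for u v
  proof -
    have \<mu>: "measure \<mu> ({..u} \<times> {..v}) =
        prob {\<omega> \<in> space M. 1 - exp (- X \<omega>) \<le> u \<and> 1 - exp (- Y \<omega>) \<le> v}"
      unfolding \<mu>_def
      by (subst measure_distr) (auto intro!: arg_cong[where f=prob] simp flip: borel_prod)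
    show ?thesis
    proof (cases "u < 1 \<and> v < 1")
      case True
      have "measure \<mu> ({..u} \<times> {..v}) = prob {\<omega> \<in> space M. X \<omega> \<le> - ln (1 - u) \<and> Y \<omega> \<le> - ln (1 - v)}"
        using True by (simp add: \<mu> one_minus_exp_le_iff)
      also have "\<dots> = copulaC a u v"
        using True that by (subst joint_cdf_nonneg) auto
      finally show ?thesis ..
    next
      case False
      \<comment> \<open>On these edges there is no finite quantile, but the constraint belonging to
        the edge always holds. The rectangle then has the mass given by the other, uniform
        marginal.\<close>
      then consider "u = 1" | "v = 1"
        using \<open>u \<in> {0..1}\<close> \<open>v \<in> {0..1}\<close> by force
      then show ?thesis
      proof cases
        case 1
        have "measure \<mu> ({..u} \<times> {..v}) = cdf (distr M borel (\<lambda>\<omega>. 1 - exp (- Y \<omega>))) v"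
          unfolding \<mu> using 1 by (simp add: cdf_distr)
        then show ?thesis
          using 1 that by (simp add: V cdf_def copulaC_def)
      next
        case 2
        have "measure \<mu> ({..u} \<times> {..v}) = cdf (distr M borel (\<lambda>\<omega>. 1 - exp (- X \<omega>))) u"
          unfolding \<mu> using 2 by (simp add: cdf_distr)
        then show ?thesis
          using 2 that by (simp add: U cdf_def copulaC_def)
      qed
    qed
  qed
  show ?thesis
    unfolding is_copula_def
  proof (intro exI[of _ \<mu>] conjI ballI)
    show "prob_space \<mu>"
      unfolding \<mu>_def by (intro prob_space_distr) (simp flip: borel_prod)
  qed (use fst snd C in \<open>auto simp: \<mu>_def\<close>)
qed

section \<open>Second form of the formula, monotonicity in the parameter, extremal copulas\<close>

text \<open>The positive factor \<open>p = (1 - v) powr a\<close> can be moved through the positive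
  part, and \<open>(1 - v) / p\<close> is the reciprocal of
  \<open>(1 - v) powr (a - 1)\<close>.\<close>

lemma copulaC_alt:
  assumes "v < 1"
  shows "copulaC a u v = u - max ((1 - v) powr a - (1 - u)) 0 / (1 - v) powr (a - 1)"
proof -
  define p where "p = (1 - v) powr a"
  have p: "0 < p"
    using assms by (simp add: p_def)
  have "(1 - v) powr (a - 1) = p / (1 - v)"
    using assms by (simp add: p_def powr_diff)
  moreover have "max (1 - (1 - u) / p) 0 = max (p - (1 - u)) 0 / p"
    using p by (auto simp: max_def field_simps)
  ultimately show ?thesis
    using assms by (simp add: copulaC_def flip: p_def)
qed

text \<open>For \<open>v < 1\<close> the base \<open>1 - v\<close> lies in \<open>(0, 1]\<close>, so
  raising the exponent lowers the power, raises the quotient and shrinks the subtracted positive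
  part.\<close>

lemma copulaC_mono:
  assumes "a \<le> b" "u \<in> {0..1}" "v \<in> {0..1}"
  shows "copulaC a u v \<le> copulaC b u v"
proof (cases "v = 1")
  case False
  then have "(1 - v) powr b \<le> (1 - v) powr a"
    using assms by (intro powr_mono') auto
  moreover have "0 < (1 - v) powr b"
    using False assms by simp
  ultimately have "(1 - u) / (1 - v) powr a \<le> (1 - u) / (1 - v) powr b"
    using assms by (intro divide_left_mono) auto
  then have "(1 - v) * max (1 - (1 - u) / (1 - v) powr b) 0 \<le> (1 - v) * max (1 - (1 - u) / (1 - v) powr a) 0"
    using assms by (intro mult_left_mono) auto
  then show ?thesis
    using False by (simp add: copulaC_def)
qed (simp add: copulaC_def)

lemma copulaC_0:
  assumes "u \<in> {0..1}" "v \<in> {0..1}"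
  shows "copulaC 0 u v = u * v"
  using assms by (auto simp: copulaC_def algebra_simps max_def)

text \<open>For \<open>v < 1\<close> the subtracted term is the positive part of
  \<open>(1 - v) - (1 - u) = u - v\<close>, which leaves the minimum.\<close>

lemma copulaC_1:
  assumes "u \<in> {0..1}" "v \<in> {0..1}"
  shows "copulaC 1 u v = min u v"
  using assms by (auto simp: copulaC_def max_def min_def field_simps)

theorem mainTheorem1:
  fixes M :: "'w measure"
    and X Y Z B :: "'w \<Rightarrow> real"
    and rate a :: real
  shows
    "(rate > 0 \<and> 0 < a \<and> a < 1 \<and> prob_space M \<and>
      prob_space.indep_vars M (\<lambda>_. borel) (\<lambda>i::nat. [Y, Z, B] ! i) {0, 1, 2} \<and>
      distributed M lborel Y (exponential_density rate) \<and>
      distributed M lborel Z (exponential_density rate) \<and>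
      measure M {\<omega> \<in> space M. B \<omega> = 0} = a \<and>
      measure M {\<omega> \<in> space M. B \<omega> = 1} = 1 - a \<and>
      X = (\<lambda>\<omega>. a * Y \<omega> + B \<omega> * Z \<omega>)
      \<longrightarrow>
        (\<forall>x. cdf (distr M borel X) x = (if x \<ge> 0 then 1 - exp (- rate * x) else 0)) \<and>
        (\<forall>y. cdf (distr M borel Y) y = (if y \<ge> 0 then 1 - exp (- rate * y) else 0)) \<and>
        (\<forall>x y. measure M {\<omega> \<in> space M. X \<omega> \<le> x \<and> Y \<omega> \<le> y} =
           copulaC a (cdf (distr M borel X) x) (cdf (distr M borel Y) y)))
     \<and>
     (\<forall>b\<in>{0..1}.
        is_copula (copulaC b) \<and>
        (\<forall>u\<in>{0..1}. \<forall>v\<in>{0..<1}.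
           copulaC b u v = u - max ((1 - v) powr b - (1 - u)) 0 / (1 - v) powr (b - 1)) \<and>
        (\<forall>u\<in>{0..1}. \<forall>v\<in>{0..1}.
           copulaC 0 u v \<le> copulaC b u v \<and> copulaC b u v \<le> copulaC 1 u v))
     \<and>
     (\<forall>u\<in>{0..1}. \<forall>v\<in>{0..1}. copulaC 0 u v = u * v \<and> copulaC 1 u v = min u v)"
proof (intro conjI)
  show "rate > 0 \<and> 0 < a \<and> a < 1 \<and> prob_space M \<and>
      prob_space.indep_vars M (\<lambda>_. borel) (\<lambda>i::nat. [Y, Z, B] ! i) {0, 1, 2} \<and>
      distributed M lborel Y (exponential_density rate) \<and>
      distributed M lborel Z (exponential_density rate) \<and>
      measure M {\<omega> \<in> space M. B \<omega> = 0} = a \<and>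
      measure M {\<omega> \<in> space M. B \<omega> = 1} = 1 - a \<and>
      X = (\<lambda>\<omega>. a * Y \<omega> + B \<omega> * Z \<omega>)
      \<longrightarrow>
        (\<forall>x. cdf (distr M borel X) x = (if x \<ge> 0 then 1 - exp (- rate * x) else 0)) \<and>
        (\<forall>y. cdf (distr M borel Y) y = (if y \<ge> 0 then 1 - exp (- rate * y) else 0)) \<and>
        (\<forall>x y. measure M {\<omega> \<in> space M. X \<omega> \<le> x \<and> Y \<omega> \<le> y} =
           copulaC a (cdf (distr M borel X) x) (cdf (distr M borel Y) y))"
  proof (rule impI, elim conjE)
    assume X: "X = (\<lambda>\<omega>. a * Y \<omega> + B \<omega> * Z \<omega>)" and "prob_space M"
      and asms: "rate > 0" "0 < a" "a < 1"
        "prob_space.indep_vars M (\<lambda>_. borel) (\<lambda>i::nat. [Y, Z, B] ! i) {0, 1, 2}"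
        "distributed M lborel Y (exponential_density rate)"
        "distributed M lborel Z (exponential_density rate)"
        "measure M {\<omega> \<in> space M. B \<omega> = 0} = a"
        "measure M {\<omega> \<in> space M. B \<omega> = 1} = 1 - a"
    interpret prob_space M
      by fact
    interpret mix: exponential_mixture M Y Z B rate a
      using asms by unfold_locales auto
    have "X = mix.X"
      by (simp add: X mix.X_def fun_eq_iff)
    then show "(\<forall>x. cdf (distr M borel X) x = (if x \<ge> 0 then 1 - exp (- rate * x) else 0)) \<and>
        (\<forall>y. cdf (distr M borel Y) y = (if y \<ge> 0 then 1 - exp (- rate * y) else 0)) \<and>
        (\<forall>x y. measure M {\<omega> \<in> space M. X \<omega> \<le> x \<and> Y \<omega> \<le> y} =
           copulaC a (cdf (distr M borel X) x) (cdf (distr M borel Y) y))"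
      using mix.cdf_X mix.cdf_Y mix.joint_cdf by blast
  qed
\<comment> \<open>The bounds by the extremal copulas are monotonicity in the parameter, applied from
  0 to \<open>b\<close> and from \<open>b\<close> to 1.\<close>
qed (auto simp: is_copula_copulaC copulaC_alt intro!: copulaC_mono copulaC_0 copulaC_1)

end
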